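(* Let $n\geq m\geq 2$ and $m\geq k\geq 1$ be integers. If $A$ is a complex $m\times n$ matrix, then $$\|A\|_{F_k}\leq \sqrt{kmn}\,|A|_\infty.$$ Equality is possible if and only if all entries of $A$ have the same absolute value, $A$ has exactly $k$ nonzero singular values and they are equal.
   Context: For a complex $m\times n$ matrix $A=[a_{ij}]$ with $m\le n$, $\sigma_1(A)\geq\cdots\geq\sigma_m(A)$ denote its singular values, i.e. the square roots of the eigenvalues of $AA^*$ (where $A^*$ is the Hermitian adjoint of $A$), listed with multiplicity; $\|A\|_{F_k}=\sigma_1(A)+\cdots+\sigma_k(A)$ is the Ky Fan $k$-norm; and $|A|_\infty=\max_{i,j}|a_{ij}|$.
   Formalization: The characterization of equality is stated only for nonzero A: for A = 0 equality holds (both sides are 0), but A has no nonzero singular values whereas k is at least 1, so the equivalence fails there. *)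

theory Defs
  imports
    "Jordan_Normal_Form.Char_Poly"
    "Jordan_Normal_Form.Schur_Decomposition"
    "HOL-Library.Multiset"
    "HOL-Computational_Algebra.Fundamental_Theorem_Algebra"
begin

text \<open>The eigenvalues of \<open>A * mat_adjoint A\<close>, listed with multiplicity, are the roots of its
  characteristic polynomial. The matrix is positive semidefinite, so these roots are real and
  nonnegative, and \<open>Re\<close> only converts them to type \<^typ>\<open>real\<close>. The list is 0-based:
  \<open>singular_values A ! i\<close> is the value written $\sigma_{i+1}(A)$.\<close>

definition singular_values :: "complex mat \<Rightarrow> real list" where
  "singular_values A =
     rev (sorted_list_of_multiset
       (image_mset (\<lambda>x. sqrt (Re x)) (proots (char_poly (A * mat_adjoint A)))))"

definition ky_fan_norm :: "nat \<Rightarrow> complex mat \<Rightarrow> real" where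
  "ky_fan_norm k A = (\<Sum>i<k. singular_values A ! i)"

text \<open>Only meaningful for matrices with at least one row and one column, since \<^const>\<open>Max\<close> of
  the empty set is unspecified.\<close>

definition max_abs_entry :: "complex mat \<Rightarrow> real" where
  "max_abs_entry A = Max (cmod ` elements_mat A)"

lemma length_singular_values:
  assumes A: "A \<in> carrier_mat m n"
  shows "length (singular_values A) = m"
proof -
  have "mat_adjoint A \<in> carrier_mat n m"
    using A unfolding mat_adjoint_def by auto
  hence "A * mat_adjoint A \<in> carrier_mat m m"
    using A by auto
  hence "degree (char_poly (A * mat_adjoint A)) = m"
    by (simp add: degree_monic_char_poly)
  moreover have "length (sorted_list_of_multiset M) = size M" for M :: "real multiset"
    by (metis mset_sorted_list_of_multiset size_mset)
  ultimately show ?thesis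
    by (simp add: singular_values_def size_proots_complex)
qed

end

theory Submission
  imports Defs
begin

text \<open>
  Let \<open>s\<^sub>i\<close> be the singular values, \<open>S\<close> the sum of the first \<open>k\<close> of them and \<open>M\<close> the largest
  absolute value of an entry \<open>a\<^sub>i\<^sub>j\<close>. Since the squares of the \<open>s\<^sub>i\<close> add up to the trace of
  \<open>A A\<^sup>*\<close>, which is the sum of the \<open>|a\<^sub>i\<^sub>j|\<^sup>2\<close>, the difference \<open>k m n M\<^sup>2 - S\<^sup>2\<close> is \<open>k\<close> times the sum of
  three nonnegative quantities: the square deviation of \<open>s\<^sub>1, ..., s\<^sub>k\<close> from their mean \<open>S / k\<close>,
  the sum of the remaining \<open>s\<^sub>i\<^sup>2\<close>, and the sum of the \<open>M\<^sup>2 - |a\<^sub>i\<^sub>j|\<^sup>2\<close>. Equality means that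
  all three vanish.
\<close>

section \<open>Traces and eigenvalue sums of complex matrices\<close>

lemma trace_mult_commute:
  fixes X Y :: "'a::comm_semiring_0 mat"
  assumes "X \<in> carrier_mat m n" "Y \<in> carrier_mat n m"
  shows "(\<Sum>i<m. (X * Y) $$ (i,i)) = (\<Sum>j<n. (Y * X) $$ (j,j))"
proof -
  have "(\<Sum>i<m. (X * Y) $$ (i,i)) = (\<Sum>i<m. \<Sum>j<n. X $$ (i,j) * Y $$ (j,i))"
    using assms by (intro sum.cong) (auto simp: scalar_prod_def atLeast0LessThan)
  also have "\<dots> = (\<Sum>j<n. \<Sum>i<m. X $$ (i,j) * Y $$ (j,i))"
    by (rule sum.swap)
  also have "\<dots> = (\<Sum>j<n. (Y * X) $$ (j,j))"
    using assms by (intro sum.cong) (auto simp: scalar_prod_def atLeast0LessThan mult.commute)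
  finally show ?thesis .
qed

text \<open>Write \<open>A\<close> as \<open>P * (B * Q)\<close>, move \<open>P\<close> cyclically
  to the end, and cancel \<open>Q * P = 1\<close>.\<close>

lemma trace_similar_mat_wit:
  fixes A B :: "'a::comm_semiring_1 mat"
  assumes A: "A \<in> carrier_mat n n" and sim: "similar_mat_wit A B P Q"
  shows "(\<Sum>i<n. A $$ (i,i)) = (\<Sum>i<n. B $$ (i,i))"
proof -
  note w = similar_mat_witD2[OF A sim]
  have "(\<Sum>i<n. A $$ (i,i)) = (\<Sum>i<n. (P * (B * Q)) $$ (i,i))"
    using w by (simp add: assoc_mult_mat[of P n n B n Q n])
  also have "\<dots> = (\<Sum>i<n. (B * Q * P) $$ (i,i))"
    using w by (intro trace_mult_commute) auto
  also have "B * Q * P = B"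
    using w by (simp add: assoc_mult_mat[of B n n Q n P n])
  finally show ?thesis .
qed

text \<open>Over the complex numbers the characteristic polynomial splits, so Schur decomposition
  gives a triangular matrix similar to \<open>B\<close> whose diagonal lists the roots with
  multiplicity. Similarity preserves the trace.\<close>

lemma sum_proots_char_poly:
  fixes B :: "complex mat"
  assumes B: "B \<in> carrier_mat m m"
  shows "\<Sum>\<^sub># (proots (char_poly B)) = (\<Sum>i<m. B $$ (i,i))"
proof -
  obtain as where cp: "char_poly B = (\<Prod>a\<leftarrow>as. [:- a, 1:])"
    using char_poly_factorized[OF B] by blast
  obtain T P Q where dec: "schur_decomposition B as = (T, P, Q)"
    by (metis prod_cases3)
  from schur_decomposition[OF B cp dec]
  have sim: "similar_mat_wit B T P Q" and diag: "diag_mat T = as"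
    by auto
  have T: "T \<in> carrier_mat m m"
    using similar_mat_witD2[OF B sim] by auto
  have "proots (char_poly B) = (\<Sum>p\<leftarrow>map (\<lambda>a. [:- a, 1:]) as. proots p)"
    unfolding cp by (subst proots_prod_list[symmetric]) (auto simp: o_def)
  also have "\<dots> = mset as"
    by (induction as) auto
  finally have "\<Sum>\<^sub># (proots (char_poly B)) = sum_list as"
    by (simp add: sum_mset_sum_list)
  also have "\<dots> = (\<Sum>i<m. T $$ (i,i))"
    using T by (simp add: diag[symmetric] diag_mat_def sum_list_sum_nth atLeast0LessThan)
  also have "\<dots> = (\<Sum>i<m. B $$ (i,i))"
    using trace_similar_mat_wit[OF B sim] by simp
  finally show ?thesis .
qed

section \<open>The adjoint and positive semidefiniteness of \<open>A * mat_adjoint A\<close>\<close>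

lemma mat_adjoint_carrier:
  "A \<in> carrier_mat m n \<Longrightarrow> mat_adjoint A \<in> carrier_mat n m"
  by (auto simp: mat_adjoint_def)

lemma mat_adjoint_index:
  fixes A :: "complex mat"
  assumes "A \<in> carrier_mat m n" "i < m" "j < n"
  shows "mat_adjoint A $$ (j,i) = cnj (A $$ (i,j))"
  using assms by (simp add: mat_adjoint_def mat_of_rows_index)

lemma mult_mat_vec_cscalar_prod:
  fixes A :: "complex mat"
  assumes A: "A \<in> carrier_mat m n" and w: "w \<in> carrier_vec n" and v: "v \<in> carrier_vec m"
  shows "(A *\<^sub>v w) \<bullet>c v = w \<bullet>c (mat_adjoint A *\<^sub>v v)"
proof -
  have "(A *\<^sub>v w) \<bullet>c v = (\<Sum>i<m. \<Sum>j<n. A $$ (i,j) * w $ j * cnj (v $ i))"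
    using A w v by (auto simp: scalar_prod_def atLeast0LessThan sum_distrib_right)
  also have "\<dots> = (\<Sum>j<n. \<Sum>i<m. A $$ (i,j) * w $ j * cnj (v $ i))"
    by (rule sum.swap)
  also have "\<dots> = w \<bullet>c (mat_adjoint A *\<^sub>v v)"
    using mat_adjoint_carrier[OF A] A w v
    by (auto simp: scalar_prod_def atLeast0LessThan sum_distrib_left mat_adjoint_index[OF A]
        mult_ac intro!: sum.cong)
  finally show ?thesis .
qed

text \<open>For an eigenvector \<open>v\<close>, moving \<open>A\<close> across the inner product
  shows that \<open>x\<close> times the squared norm of \<open>v\<close> is the squared norm of
  \<open>mat_adjoint A *\<^sub>v v\<close>. In the order on \<open>complex\<close>,
  \<open>0 \<le> x\<close> also says that \<open>x\<close> is real.\<close>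

lemma eigenvalue_mult_mat_adjoint_nonneg:
  fixes A :: "complex mat"
  assumes A: "A \<in> carrier_mat m n" and x: "eigenvalue (A * mat_adjoint A) x"
  shows "0 \<le> x"
proof -
  have H: "mat_adjoint A \<in> carrier_mat n m"
    by (rule mat_adjoint_carrier[OF A])
  obtain v where v: "v \<in> carrier_vec m" "v \<noteq> 0\<^sub>v m"
    and eq: "(A * mat_adjoint A) *\<^sub>v v = x \<cdot>\<^sub>v v"
    using x A by (auto simp: eigenvalue_def eigenvector_def)
  define w where "w = mat_adjoint A *\<^sub>v v"
  have w: "w \<in> carrier_vec n"
    using H v by (auto simp: w_def)
  have "x * (v \<bullet>c v) = (A *\<^sub>v w) \<bullet>c v"
    using eq v A H by (simp add: w_def assoc_mult_mat_vec[of A m n "mat_adjoint A" m v])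
  also have "\<dots> = w \<bullet>c w"
    unfolding w_def using mult_mat_vec_cscalar_prod[OF A w v(1)] w_def by simp
  finally have "0 \<le> x * (v \<bullet>c v)"
    by (metis conjugate_square_ge_0_vec)
  moreover have "0 < v \<bullet>c v"
    using v by simp
  ultimately show ?thesis
    by (auto simp: less_eq_complex_def less_complex_def zero_le_mult_iff)
qed

lemma proots_mult_mat_adjoint_nonneg:
  fixes A :: "complex mat"
  assumes A: "A \<in> carrier_mat m n" and x: "x \<in># proots (char_poly (A * mat_adjoint A))"
  shows "0 \<le> x"
proof -
  have B: "A * mat_adjoint A \<in> carrier_mat m m"
    using A mat_adjoint_carrier[OF A] by auto
  have "char_poly (A * mat_adjoint A) \<noteq> 0"
    using degree_monic_char_poly[OF B] by auto
  with x have "eigenvalue (A * mat_adjoint A) x"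
    unfolding eigenvalue_root_char_poly[OF B] by simp
  then show ?thesis
    by (rule eigenvalue_mult_mat_adjoint_nonneg[OF A])
qed

section \<open>Singular values: sign, order and sum of squares\<close>

lemma mset_singular_values:
  "mset (singular_values A) =
    image_mset (\<lambda>x. sqrt (Re x)) (proots (char_poly (A * mat_adjoint A)))"
  by (simp add: singular_values_def)

lemma singular_values_nonneg:
  assumes "A \<in> carrier_mat m n" "s \<in> set (singular_values A)"
  shows "0 \<le> s"
proof -
  have "s \<in># mset (singular_values A)"
    using assms(2) by simp
  then show ?thesis
    unfolding mset_singular_values
    using proots_mult_mat_adjoint_nonneg[OF assms(1)] by (auto simp: less_eq_complex_def)
qed

lemma singular_values_antimono:
  assumes "i \<le> j" "j < length (singular_values A)"
  shows "singular_values A ! j \<le> singular_values A ! i"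
proof -
  have "sorted (rev (singular_values A))"
    by (simp add: singular_values_def)
  then show ?thesis
    using assms by (simp add: sorted_rev_iff_nth_mono)
qed

text \<open>Both sides are the trace of \<open>A * mat_adjoint A\<close>, once as the sum of its
  eigenvalues and once read off its diagonal. This links the spectrum to the entries; the common
  value is the squared Frobenius norm.\<close>

lemma sum_singular_values_square:
  assumes A: "A \<in> carrier_mat m n"
  shows "(\<Sum>i<m. (singular_values A ! i)\<^sup>2) = (\<Sum>i<m. \<Sum>j<n. (cmod (A $$ (i,j)))\<^sup>2)"
proof -
  let ?B = "A * mat_adjoint A"
  let ?R = "proots (char_poly ?B)"
  have H: "mat_adjoint A \<in> carrier_mat n m" and B: "?B \<in> carrier_mat m m"
    using A mat_adjoint_carrier[OF A] by auto
  have Re_sum: "Re (\<Sum>\<^sub># X) = (\<Sum>x\<in>#X. Re x)" for X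
    by (induction X) auto
  have diag: "?B $$ (i,i) = of_real (\<Sum>j<n. (cmod (A $$ (i,j)))\<^sup>2)" if "i < m" for i
    using that A H
    by (auto simp: scalar_prod_def atLeast0LessThan mat_adjoint_index[OF A] complex_norm_square
        simp del: of_real_power intro!: sum.cong)
  have "(\<Sum>i<m. (singular_values A ! i)\<^sup>2) = (\<Sum>s\<in>#mset (singular_values A). s\<^sup>2)"
    by (simp flip: mset_map add: sum_mset_sum_list sum_list_sum_nth atLeast0LessThan
        length_singular_values[OF A])
  also have "\<dots> = (\<Sum>x\<in>#?R. (sqrt (Re x))\<^sup>2)"
    unfolding mset_singular_values by (simp add: image_mset.compositionality o_def)
  \<comment> \<open>Positive semidefiniteness enters here: at a negative argument the square of
    \<open>sqrt\<close> would be the absolute value.\<close>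
  also have "\<dots> = (\<Sum>x\<in>#?R. Re x)"
    using proots_mult_mat_adjoint_nonneg[OF A]
    by (intro arg_cong[where f = sum_mset] image_mset_cong) (auto simp: less_eq_complex_def)
  also have "\<dots> = Re (\<Sum>i<m. ?B $$ (i,i))"
    unfolding Re_sum[symmetric] sum_proots_char_poly[OF B] ..
  also have "\<dots> = (\<Sum>i<m. \<Sum>j<n. (cmod (A $$ (i,j)))\<^sup>2)"
    by (simp add: diag del: of_real_sum)
  finally show ?thesis .
qed

section \<open>The largest absolute value of an entry\<close>

lemma finite_elements_mat: "finite (elements_mat A)"
  by (simp add: elements_mat_def)

lemma cmod_le_max_abs_entry:
  "x \<in> elements_mat A \<Longrightarrow> cmod x \<le> max_abs_entry A"
  by (simp add: max_abs_entry_def finite_elements_mat)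

lemma max_abs_entry_attained:
  assumes "A \<in> carrier_mat m n" "0 < m" "0 < n"
  obtains x where "x \<in> elements_mat A" "max_abs_entry A = cmod x"
proof -
  have "A $$ (0,0) \<in> elements_mat A"
    using assms by auto
  then have "Max (cmod ` elements_mat A) \<in> cmod ` elements_mat A"
    by (intro Max_in) (auto simp: finite_elements_mat)
  then show ?thesis
    using that by (auto simp: max_abs_entry_def)
qed

section \<open>Two facts about finite real sequences\<close>

text \<open>Expand the squares around the mean \<open>c\<close>; the linear term is
  \<open>- 2 * k * c\<^sup>2\<close>. This is the Cauchy-Schwarz inequality against the constant
  sequence 1, with its defect made explicit.\<close>

lemma sum_square_deviation:
  fixes f :: "nat \<Rightarrow> real"
  assumes "k > 0"
  shows "k * (\<Sum>i<k. (f i - (\<Sum>i<k. f i) / k)\<^sup>2) = k * (\<Sum>i<k. (f i)\<^sup>2) - (\<Sum>i<k. f i)\<^sup>2"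
proof -
  define c where "c = (\<Sum>i<k. f i) / k"
  have c: "(\<Sum>i<k. f i) = k * c"
    using assms by (simp add: c_def)
  have "(\<Sum>i<k. (f i - c)\<^sup>2) = (\<Sum>i<k. (f i)\<^sup>2) - 2 * c * (\<Sum>i<k. f i) + k * c\<^sup>2"
    by (simp add: power2_diff sum.distrib sum_subtractf sum_distrib_left mult_ac)
  also have "\<dots> = (\<Sum>i<k. (f i)\<^sup>2) - k * c\<^sup>2"
    unfolding c by (simp add: power2_eq_square)
  finally have "k * (\<Sum>i<k. (f i - c)\<^sup>2) = k * (\<Sum>i<k. (f i)\<^sup>2) - (k * c)\<^sup>2"
    by (simp add: right_diff_distrib power_mult_distrib power2_eq_square)
  then show ?thesis
    unfolding c_def[symmetric] c[symmetric] .
qed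

text \<open>If \<open>f i\<close> is nonzero, it is positive, and so are all earlier values; these
  \<open>i + 1\<close> indices give \<open>i < k\<close>. The inclusion in \<open>{..<k}\<close> is
  an equality because the cardinalities agree.\<close>

lemma nonzero_indices_antimono:
  fixes f :: "nat \<Rightarrow> real"
  assumes anti: "\<And>i j. i \<le> j \<Longrightarrow> j < m \<Longrightarrow> f j \<le> f i"
    and nonneg: "\<And>i. i < m \<Longrightarrow> 0 \<le> f i"
    and card: "card {i. i < m \<and> f i \<noteq> 0} = k"
  shows "{i. i < m \<and> f i \<noteq> 0} = {..<k}"
proof (rule card_subset_eq)
  show "{i. i < m \<and> f i \<noteq> 0} \<subseteq> {..<k}"
  proof clarsimp
    fix i assume i: "i < m" "f i \<noteq> 0"
    then have "{..i} \<subseteq> {i. i < m \<and> f i \<noteq> 0}"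
      using anti[of _ i] nonneg[of i] by force
    then have "card {..i} \<le> card {i. i < m \<and> f i \<noteq> 0}"
      by (intro card_mono) auto
    then show "i < k"
      using card by simp
  qed
qed (simp_all add: card)

section \<open>The Ky Fan norm bound and its equality case\<close>

text \<open>The equality case excludes the zero matrix: there both sides of the bound are 0, but no
  singular value is nonzero, while \<open>k \<ge> 1\<close>.\<close>

theorem theorem12:
  fixes m n k :: nat and A :: "complex mat"
  assumes "n \<ge> m" and "m \<ge> 2" and "m \<ge> k" and "k \<ge> 1"
    and "A \<in> carrier_mat m n"
  shows "ky_fan_norm k A \<le> sqrt (real (k * m * n)) * max_abs_entry A \<and>
    (A \<noteq> 0\<^sub>m m n \<longrightarrow>
      (ky_fan_norm k A = sqrt (real (k * m * n)) * max_abs_entry A \<longleftrightarrow>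
        (\<forall>x \<in> elements_mat A. \<forall>y \<in> elements_mat A. cmod x = cmod y) \<and>
        length (filter (\<lambda>s. s \<noteq> 0) (singular_values A)) = k \<and>
        (\<forall>s \<in> set (singular_values A). \<forall>t \<in> set (singular_values A).
           s \<noteq> 0 \<longrightarrow> t \<noteq> 0 \<longrightarrow> s = t)))"
proof -
  note A = assms(5)
  define s where "s i = singular_values A ! i" for i
  define a where "a i j = cmod (A $$ (i,j))" for i j
  define M where "M = max_abs_entry A"
  define S where "S = (\<Sum>i<k. s i)"
  define D where "D = (\<Sum>i<k. (s i - S / k)\<^sup>2)"
  define T where "T = (\<Sum>i\<in>{k..<m}. (s i)\<^sup>2)"
  define E where "E = (\<Sum>i<m. \<Sum>j<n. M\<^sup>2 - (a i j)\<^sup>2)"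
  have len: "length (singular_values A) = m"
    by (rule length_singular_values[OF A])
  have s_nonneg: "0 \<le> s i" if "i < m" for i
    using that singular_values_nonneg[OF A] by (simp add: s_def len)
  have s_anti: "s j \<le> s i" if "i \<le> j" "j < m" for i j
    using that singular_values_antimono by (simp add: s_def len)
  \<comment> \<open>The conditions on the list are moved to indices, where multiplicities are kept
    and the decreasing order can be used.\<close>
  have equal_s: "(\<forall>x \<in> set (singular_values A). \<forall>y \<in> set (singular_values A).
      x \<noteq> 0 \<longrightarrow> y \<noteq> 0 \<longrightarrow> x = y) \<longleftrightarrow>
      (\<forall>i<m. \<forall>j<m. s i \<noteq> 0 \<longrightarrow> s j \<noteq> 0 \<longrightarrow> s i = s j)"
    unfolding all_set_conv_all_nth len s_def by blast
  have filter_s: "length (filter (\<lambda>s. s \<noteq> 0) (singular_values A)) = card {i. i < m \<and> s i \<noteq> 0}"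
    by (simp add: length_filter_conv_card len s_def)
  have "0 < m" "0 < n"
    using assms by auto
  then obtain x0 where x0: "x0 \<in> elements_mat A" "M = cmod x0"
    unfolding M_def by (rule max_abs_entry_attained[OF A])
  have M_nonneg: "0 \<le> M"
    by (simp add: x0)
  have a_le: "a i j \<le> M" if "i < m" "j < n" for i j
    unfolding a_def M_def using that A by (intro cmod_le_max_abs_entry) auto
  have a_sq_le: "(a i j)\<^sup>2 \<le> M\<^sup>2" if "i < m" "j < n" for i j
    using a_le[OF that] by (intro power_mono) (auto simp: a_def)
  have norm_S: "ky_fan_norm k A = S"
    by (simp add: ky_fan_norm_def S_def s_def)
  have S_nonneg: "0 \<le> S"
    unfolding S_def using assms by (intro sum_nonneg s_nonneg) auto
  have squares: "(\<Sum>i<m. (s i)\<^sup>2) = (\<Sum>i<m. \<Sum>j<n. (a i j)\<^sup>2)"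
    unfolding s_def a_def by (rule sum_singular_values_square[OF A])
  have "(\<Sum>i<k. (s i)\<^sup>2) + T = (\<Sum>i<m. (s i)\<^sup>2)"
    using assms sum.union_disjoint[of "{..<k}" "{k..<m}" "\<lambda>i. (s i)\<^sup>2"]
    by (simp add: T_def ivl_disj_un ivl_disj_int)
  also have "\<dots> + E = m * n * M\<^sup>2"
    unfolding E_def squares by (simp add: sum_subtractf)
  finally have sum_first: "(\<Sum>i<k. (s i)\<^sup>2) = m * n * M\<^sup>2 - T - E"
    by simp
  have "k * D = k * (\<Sum>i<k. (s i)\<^sup>2) - S\<^sup>2"
    unfolding D_def S_def using assms by (intro sum_square_deviation) auto
  \<comment> \<open>An exact identity rather than an estimate, so it yields the bound and the
    equality case together.\<close>
  then have gap: "(sqrt (real (k * m * n)) * M)\<^sup>2 = S\<^sup>2 + k * (D + T + E)"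
    unfolding sum_first by (simp add: power_mult_distrib right_diff_distrib distrib_left)
  have nonneg: "0 \<le> D" "0 \<le> T" "0 \<le> E"
    unfolding D_def T_def E_def using a_sq_le by (auto intro!: sum_nonneg)
  have "S \<le> sqrt (real (k * m * n)) * M"
  proof (rule power2_le_imp_le)
    show "S\<^sup>2 \<le> (sqrt (real (k * m * n)) * M)\<^sup>2"
      unfolding gap using nonneg by simp
  qed (use M_nonneg in simp)
  moreover have "S = sqrt (real (k * m * n)) * M \<longleftrightarrow>
      (\<forall>x \<in> elements_mat A. \<forall>y \<in> elements_mat A. cmod x = cmod y) \<and>
      card {i. i < m \<and> s i \<noteq> 0} = k \<and>
      (\<forall>i<m. \<forall>j<m. s i \<noteq> 0 \<longrightarrow> s j \<noteq> 0 \<longrightarrow> s i = s j)" if A0: "A \<noteq> 0\<^sub>m m n"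
  proof -
    have "S = sqrt (real (k * m * n)) * M \<longleftrightarrow> (sqrt (real (k * m * n)) * M)\<^sup>2 = S\<^sup>2"
      using S_nonneg M_nonneg by (subst power2_eq_iff_nonneg) auto
    also have "\<dots> \<longleftrightarrow> D = 0 \<and> T = 0 \<and> E = 0"
      unfolding gap using nonneg assms by auto
    finally have eq_iff: "S = sqrt (real (k * m * n)) * M \<longleftrightarrow> D = 0 \<and> T = 0 \<and> E = 0" .
    have D: "D = 0 \<longleftrightarrow> (\<forall>i<k. s i = S / k)"
      unfolding D_def by (subst sum_nonneg_eq_0_iff) auto
    have T: "T = 0 \<longleftrightarrow> (\<forall>i. k \<le> i \<and> i < m \<longrightarrow> s i = 0)"
      unfolding T_def by (subst sum_nonneg_eq_0_iff) auto
    have "E = 0 \<longleftrightarrow> (\<forall>i<m. (\<Sum>j<n. M\<^sup>2 - (a i j)\<^sup>2) = 0)"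
      unfolding E_def using a_sq_le
      by (subst sum_nonneg_eq_0_iff) (auto intro!: sum_nonneg)
    also have "\<dots> \<longleftrightarrow> (\<forall>i<m. \<forall>j<n. M\<^sup>2 - (a i j)\<^sup>2 = 0)"
      using a_sq_le
      by (intro all_cong) (subst sum_nonneg_eq_0_iff, auto)
    also have "\<dots> \<longleftrightarrow> (\<forall>i<m. \<forall>j<n. a i j = M)"
      using M_nonneg by (auto simp: a_def)
    also have "\<dots> \<longleftrightarrow> (\<forall>x \<in> elements_mat A. cmod x = M)"
      using A unfolding a_def by (auto dest!: elements_matD)
    \<comment> \<open>\<open>M\<close> is attained at the entry \<open>x0\<close>, so a common
      absolute value can only be \<open>M\<close>.\<close>
    also have "\<dots> \<longleftrightarrow> (\<forall>x \<in> elements_mat A. \<forall>y \<in> elements_mat A. cmod x = cmod y)"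
      using x0 by metis
    finally have E: "E = 0 \<longleftrightarrow>
      (\<forall>x \<in> elements_mat A. \<forall>y \<in> elements_mat A. cmod x = cmod y)" .
    have "D = 0 \<and> T = 0 \<longleftrightarrow> card {i. i < m \<and> s i \<noteq> 0} = k \<and>
      (\<forall>i<m. \<forall>j<m. s i \<noteq> 0 \<longrightarrow> s j \<noteq> 0 \<longrightarrow> s i = s j)"
    proof
      assume DT: "D = 0 \<and> T = 0"
      \<comment> \<open>Here \<open>A\<close> being nonzero is used: if \<open>S\<close> were 0, all
        singular values would vanish, and by \<open>squares\<close> all entries too. Hence the first
        \<open>k\<close> singular values, all equal to \<open>S / k\<close>, are nonzero.\<close>
      have "S \<noteq> 0"
      proof
        assume "S = 0"
        with DT D T have "s i = 0" if "i < m" for i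
          using that by (cases "i < k") auto
        then have "(\<Sum>i<m. \<Sum>j<n. (a i j)\<^sup>2) = 0"
          using squares by simp
        then have "\<forall>i<m. (\<Sum>j<n. (a i j)\<^sup>2) = 0"
          by (subst (asm) sum_nonneg_eq_0_iff) (auto intro!: sum_nonneg)
        then have "\<forall>i<m. \<forall>j<n. a i j = 0"
          by (simp add: sum_nonneg_eq_0_iff Ball_def)
        then have "A = 0\<^sub>m m n"
          using A by (intro eq_matI) (auto simp: a_def)
        with A0 show False ..
      qed
      then have nz: "s i \<noteq> 0 \<longleftrightarrow> i < k" if "i < m" for i
        using that DT D T assms by (cases "i < k") auto
      then have "{i. i < m \<and> s i \<noteq> 0} = {..<k}"
        using nz \<open>m \<ge> k\<close> by (auto dest: less_le_trans)
      moreover have "s i = s j" if "i < m" "j < m" "s i \<noteq> 0" "s j \<noteq> 0" for i j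
        using that nz DT D by metis
      ultimately show "card {i. i < m \<and> s i \<noteq> 0} = k \<and>
        (\<forall>i<m. \<forall>j<m. s i \<noteq> 0 \<longrightarrow> s j \<noteq> 0 \<longrightarrow> s i = s j)"
        by auto
    next
      assume R: "card {i. i < m \<and> s i \<noteq> 0} = k \<and>
        (\<forall>i<m. \<forall>j<m. s i \<noteq> 0 \<longrightarrow> s j \<noteq> 0 \<longrightarrow> s i = s j)"
      \<comment> \<open>Only the number of nonzero singular values is given; the decreasing order
        places them at the first \<open>k\<close> indices, so that \<open>s 0\<close> is their
        common value and also the mean \<open>S / k\<close>.\<close>
      then have nz: "{i. i < m \<and> s i \<noteq> 0} = {..<k}"
        using s_anti s_nonneg by (intro nonzero_indices_antimono) auto
      have const: "s i = s 0" if "i < k" for i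
      proof -
        have "i \<in> {i. i < m \<and> s i \<noteq> 0}" "0 \<in> {i. i < m \<and> s i \<noteq> 0}"
          unfolding nz using that by auto
        then show ?thesis
          using R by blast
      qed
      have "S = (\<Sum>i<k. s 0)"
        unfolding S_def by (intro sum.cong refl const) simp
      then have "S / k = s 0"
        using assms by simp
      then have "D = 0"
        unfolding D using const by metis
      moreover have "T = 0"
        unfolding T using nz by (metis (mono_tags, lifting) lessThan_iff mem_Collect_eq not_le)
      ultimately show "D = 0 \<and> T = 0" ..
    qed
    then show ?thesis
      unfolding eq_iff E[symmetric] by blast
  qed
  ultimately show ?thesis
    unfolding norm_S M_def[symmetric] filter_s equal_s
    by blast
qed

end
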